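(* Let $Q$ be a smooth $n$-dimensional manifold, let $L\in C^\infty(TQ)$ be a regular Lagrangian with Lagrangian vector field $\Gamma_L$, and let $X\colon Q\to TQ$ be a vector field on $Q$. Then $X$ is a solution of the generalized Lagrangian Hamilton--Jacobi problem if, and only if, $X$ and $\Gamma_L$ are $X$-related, that is, $$\Gamma_L\circ X=TX\circ X.$$
   Context: $\tau_Q\colon TQ\to Q$ has natural coordinates $(q^i,v^i)$. For $L\in C^\infty(TQ)$: $\theta_L=\frac{\partial L}{\partial v^i}dq^i$, $\omega_L=-d\theta_L$, $E_L=\Delta(L)-L$ with $\Delta=v^i\frac{\partial}{\partial v^i}$ the Liouville vector field. $L$ is regular if $\omega_L$ is symplectic; then $\Gamma_L$ is the unique vector field on $TQ$ with $i(\Gamma_L)\omega_L=dE_L$ (it is a second order differential equation field: $T\tau_Q\circ\Gamma_L=\mathrm{Id}_{TQ}$). A vector field on $Q$ is regarded as a section $X\colon Q\to TQ$ of $\tau_Q$, with tangent map $TX\colon TQ\to T(TQ)$. $X$ is a solution of the generalized Lagrangian Hamilton--Jacobi problem if for every integral curve $\gamma$ of $X$ (a curve in $Q$ on an open interval with $\dot\gamma=X\circ\gamma$), the curve $\dot\gamma=X\circ\gamma$ in $TQ$ is an integral curve of $\Gamma_L$. *)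

theory Defs
  imports "HOL-Analysis.Analysis"
begin

section \<open>Smooth maps between Euclidean spaces\<close>

text \<open>These two notions are meant for open sets \<open>S\<close>: the derivatives are taken in the whole space.\<close>

primrec Ck_on :: "nat \<Rightarrow> 'e::euclidean_space set \<Rightarrow> ('e \<Rightarrow> 'f::euclidean_space) \<Rightarrow> bool" where
  "Ck_on 0 S f \<longleftrightarrow> continuous_on S f"
| "Ck_on (Suc k) S f \<longleftrightarrow>
     (\<forall>x\<in>S. f differentiable (at x)) \<and> (\<forall>v. Ck_on k S (\<lambda>x. frechet_derivative f (at x) v))"

definition smooth_on :: "'e::euclidean_space set \<Rightarrow> ('e \<Rightarrow> 'f::euclidean_space) \<Rightarrow> bool" where
  "smooth_on S f \<longleftrightarrow> (\<forall>k. Ck_on k S f)"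


section \<open>Smooth manifolds\<close>

text \<open>
  A chart is a pair of its domain and its coordinate map; the values of the coordinate map outside
  the domain are irrelevant. A manifold is represented by an atlas: its underlying set is the union
  of the chart domains, and its topology is the one determined by the atlas.
\<close>

type_synonym ('a, 'e) chart = "'a set \<times> ('a \<Rightarrow> 'e)"
type_synonym ('a, 'e) atlas = "('a, 'e) chart set"

abbreviation cdom :: "('a, 'e) chart \<Rightarrow> 'a set" where "cdom \<equiv> fst"
abbreviation cmap :: "('a, 'e) chart \<Rightarrow> 'a \<Rightarrow> 'e" where "cmap \<equiv> snd"

definition cinv :: "('a, 'e) chart \<Rightarrow> 'e \<Rightarrow> 'a" where
  "cinv c = inv_into (cdom c) (cmap c)"

definition points :: "('a, 'e) atlas \<Rightarrow> 'a set" where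
  "points M = (\<Union>c\<in>M. cdom c)"

definition charts_at :: "('a, 'e) atlas \<Rightarrow> 'a \<Rightarrow> ('a, 'e) chart set" where
  "charts_at M p = {c \<in> M. p \<in> cdom c}"

text \<open>An arbitrary chart around \<open>p\<close>, used below only for chart-independent constructions.\<close>

definition chart_at :: "('a, 'e) atlas \<Rightarrow> 'a \<Rightarrow> ('a, 'e) chart" where
  "chart_at M p = (SOME c. c \<in> charts_at M p)"

definition smooth_atlas :: "('a, 'e::euclidean_space) atlas \<Rightarrow> bool" where
  "smooth_atlas M \<longleftrightarrow>
     (\<forall>c\<in>M. inj_on (cmap c) (cdom c) \<and> open (cmap c ` cdom c)) \<and>
     (\<forall>c\<in>M. \<forall>d\<in>M. open (cmap c ` (cdom c \<inter> cdom d)) \<and>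
        smooth_on (cmap c ` (cdom c \<inter> cdom d)) (cmap d \<circ> cinv c))"

definition manifold_topology :: "('a, 'e::euclidean_space) atlas \<Rightarrow> 'a topology" where
  "manifold_topology M =
     topology (\<lambda>W. W \<subseteq> points M \<and> (\<forall>c\<in>M. open (cmap c ` (cdom c \<inter> W))))"

lemma openin_manifold_topology:
  assumes "smooth_atlas M"
  shows "openin (manifold_topology M) W \<longleftrightarrow>
    W \<subseteq> points M \<and> (\<forall>c\<in>M. open (cmap c ` (cdom c \<inter> W)))"
proof -
  have "istopology (\<lambda>W. W \<subseteq> points M \<and> (\<forall>c\<in>M. open (cmap c ` (cdom c \<inter> W))))"
    unfolding istopology_def
  proof (intro conjI allI impI ballI)
    fix S T c
    assume S: "S \<subseteq> points M \<and> (\<forall>c\<in>M. open (cmap c ` (cdom c \<inter> S)))"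
      and T: "T \<subseteq> points M \<and> (\<forall>c\<in>M. open (cmap c ` (cdom c \<inter> T)))"
    show "S \<inter> T \<subseteq> points M" using S by blast
    assume c: "c \<in> M"
    then have "inj_on (cmap c) (cdom c)"
      using assms by (auto simp: smooth_atlas_def)
    then have "cmap c ` ((cdom c \<inter> S) \<inter> (cdom c \<inter> T)) =
        cmap c ` (cdom c \<inter> S) \<inter> cmap c ` (cdom c \<inter> T)"
      by (rule inj_on_image_Int) simp_all
    moreover have "cdom c \<inter> (S \<inter> T) = (cdom c \<inter> S) \<inter> (cdom c \<inter> T)"
      by blast
    ultimately have "cmap c ` (cdom c \<inter> (S \<inter> T)) =
        cmap c ` (cdom c \<inter> S) \<inter> cmap c ` (cdom c \<inter> T)"
      by simp
    moreover have "open (cmap c ` (cdom c \<inter> S))" "open (cmap c ` (cdom c \<inter> T))"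
      using S T c by blast+
    ultimately show "open (cmap c ` (cdom c \<inter> (S \<inter> T)))"
      by (simp only: open_Int)
  next
    fix K c
    assume K: "\<forall>W\<in>K. W \<subseteq> points M \<and> (\<forall>c\<in>M. open (cmap c ` (cdom c \<inter> W)))"
    show "\<Union>K \<subseteq> points M" using K by blast
    assume c: "c \<in> M"
    have "cmap c ` (cdom c \<inter> \<Union>K) = (\<Union>W\<in>K. cmap c ` (cdom c \<inter> W))"
      by blast
    moreover have "\<forall>W\<in>K. open (cmap c ` (cdom c \<inter> W))"
      using K c by blast
    ultimately show "open (cmap c ` (cdom c \<inter> \<Union>K))"
      by (simp only: open_UN)
  qed
  then show ?thesis
    unfolding manifold_topology_def by (simp only: topology_inverse')
qed

lemma topspace_manifold_topology:
  assumes "smooth_atlas M"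
  shows "topspace (manifold_topology M) = points M"
proof
  show "topspace (manifold_topology M) \<subseteq> points M"
    using openin_topspace[of "manifold_topology M"]
    by (simp only: openin_manifold_topology[OF assms])
  have "open (cmap c ` (cdom c \<inter> points M))" if "c \<in> M" for c
  proof -
    have "cdom c \<inter> points M = cdom c" using that by (auto simp: points_def)
    then show ?thesis using assms that by (simp add: smooth_atlas_def)
  qed
  then have "openin (manifold_topology M) (points M)"
    unfolding openin_manifold_topology[OF assms] by blast
  then show "points M \<subseteq> topspace (manifold_topology M)"
    by (rule openin_subset)
qed

definition smooth_manifold :: "('a, 'e::euclidean_space) atlas \<Rightarrow> bool" where
  "smooth_manifold M \<longleftrightarrow> smooth_atlas M \<and>
     Hausdorff_space (manifold_topology M) \<and> second_countable (manifold_topology M)"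

definition smooth_map ::
  "('a, 'e::euclidean_space) atlas \<Rightarrow> ('b, 'f::euclidean_space) atlas \<Rightarrow> ('a \<Rightarrow> 'b) \<Rightarrow> bool" where
  "smooth_map M N F \<longleftrightarrow>
     continuous_map (manifold_topology M) (manifold_topology N) F \<and>
     (\<forall>c\<in>M. \<forall>d\<in>N. smooth_on (cmap c ` (cdom c \<inter> F -` cdom d)) (cmap d \<circ> F \<circ> cinv c))"

definition smooth_function :: "('a, 'e::euclidean_space) atlas \<Rightarrow> ('a \<Rightarrow> real) \<Rightarrow> bool" where
  "smooth_function M f \<longleftrightarrow> (\<forall>c\<in>M. smooth_on (cmap c ` cdom c) (f \<circ> cinv c))"


section \<open>Tangent vectors and the tangent bundle\<close>

text \<open>
  A tangent vector at \<open>p\<close> is \<open>p\<close> together with the family of its coordinate vectors, one for each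
  chart around \<open>p\<close>, which transform by the derivatives of the coordinate changes.
\<close>

type_synonym ('a, 'e) tangent = "'a \<times> (('a, 'e) chart \<Rightarrow> 'e)"

definition tangent_vectors :: "('a, 'e::euclidean_space) atlas \<Rightarrow> ('a, 'e) tangent set" where
  "tangent_vectors M = {(p, \<xi>). p \<in> points M \<and> \<xi> \<in> extensional (charts_at M p) \<and>
     (\<forall>c\<in>charts_at M p. \<forall>d\<in>charts_at M p.
        \<xi> d = frechet_derivative (cmap d \<circ> cinv c) (at (cmap c p)) (\<xi> c))}"

text \<open>The tangent vector at \<open>p\<close> whose coordinate vector in the chart \<open>c\<close> is \<open>v\<close>.\<close>

definition tangent_vec ::
  "('a, 'e::euclidean_space) atlas \<Rightarrow> ('a, 'e) chart \<Rightarrow> 'a \<Rightarrow> 'e \<Rightarrow> ('a, 'e) tangent" where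
  "tangent_vec M c p v =
     (p, \<lambda>d\<in>charts_at M p. frechet_derivative (cmap d \<circ> cinv c) (at (cmap c p)) v)"

text \<open>The natural coordinates \<open>(q, v)\<close> on the tangent bundle induced by a chart of the base.\<close>

definition tangent_chart ::
  "('a, 'e::euclidean_space) atlas \<Rightarrow> ('a, 'e) chart \<Rightarrow> (('a, 'e) tangent, 'e \<times> 'e) chart" where
  "tangent_chart M c =
     ({w \<in> tangent_vectors M. fst w \<in> cdom c}, \<lambda>w. (cmap c (fst w), snd w c))"

definition tangent_bundle ::
  "('a, 'e::euclidean_space) atlas \<Rightarrow> (('a, 'e) tangent, 'e \<times> 'e) atlas" where
  "tangent_bundle M = tangent_chart M ` M"

lemma points_tangent_bundle: "points (tangent_bundle M) = tangent_vectors M"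
proof -
  have "fst w \<in> points M" if "w \<in> tangent_vectors M" for w
    using that by (cases w) (simp add: tangent_vectors_def)
  then show ?thesis
    unfolding points_def tangent_bundle_def tangent_chart_def by fastforce
qed

definition tangent_map ::
  "('a, 'e::euclidean_space) atlas \<Rightarrow> ('b, 'f::euclidean_space) atlas \<Rightarrow> ('a \<Rightarrow> 'b)
    \<Rightarrow> ('a, 'e) tangent \<Rightarrow> ('b, 'f) tangent" where
  "tangent_map M N F Z =
     (let p = fst Z; c = chart_at M p in
       (F p, \<lambda>d\<in>charts_at N (F p).
          frechet_derivative (cmap d \<circ> F \<circ> cinv c) (at (cmap c p)) (snd Z c)))"

text \<open>Only the values of a vector field on the points of the manifold are relevant.\<close>

definition vector_field ::
  "('a, 'e::euclidean_space) atlas \<Rightarrow> ('a \<Rightarrow> ('a, 'e) tangent) \<Rightarrow> bool" where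
  "vector_field M X \<longleftrightarrow> smooth_map M (tangent_bundle M) X \<and> (\<forall>p\<in>points M. fst (X p) = p)"


section \<open>Integral curves\<close>

definition differentiable_curve ::
  "('a, 'e::euclidean_space) atlas \<Rightarrow> real set \<Rightarrow> (real \<Rightarrow> 'a) \<Rightarrow> bool" where
  "differentiable_curve M I \<gamma> \<longleftrightarrow>
     continuous_map (top_of_set I) (manifold_topology M) \<gamma> \<and>
     (\<forall>t\<in>I. \<forall>c\<in>charts_at M (\<gamma> t). (cmap c \<circ> \<gamma>) differentiable (at t))"

definition velocity ::
  "('a, 'e::euclidean_space) atlas \<Rightarrow> (real \<Rightarrow> 'a) \<Rightarrow> real \<Rightarrow> ('a, 'e) tangent" where
  "velocity M \<gamma> t = (\<gamma> t, \<lambda>c\<in>charts_at M (\<gamma> t). vector_derivative (cmap c \<circ> \<gamma>) (at t))"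

definition integral_curve ::
  "('a, 'e::euclidean_space) atlas \<Rightarrow> ('a \<Rightarrow> ('a, 'e) tangent) \<Rightarrow> real set \<Rightarrow> (real \<Rightarrow> 'a) \<Rightarrow> bool"
  where
  "integral_curve M X I \<gamma> \<longleftrightarrow>
     open I \<and> is_interval I \<and> differentiable_curve M I \<gamma> \<and> (\<forall>t\<in>I. velocity M \<gamma> t = X (\<gamma> t))"


section \<open>Differential forms of low degree\<close>

text \<open>
  A 1-form is a function of one tangent vector, a 2-form a function of two tangent vectors
  with the same base point.
\<close>

definition differential ::
  "('a, 'e::euclidean_space) atlas \<Rightarrow> ('a \<Rightarrow> real) \<Rightarrow> ('a, 'e) tangent \<Rightarrow> real" where
  "differential M f Z =
     (let p = fst Z; c = chart_at M p in
       frechet_derivative (f \<circ> cinv c) (at (cmap c p)) (snd Z c))"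

text \<open>
  The exterior derivatives are those of the coordinate representations: for constant vector fields
  \<open>u\<close>, \<open>v\<close>, \<open>w\<close> in a chart, \<open>d\<alpha>(u,v) = u(\<alpha>(v)) - v(\<alpha>(u))\<close> and
  \<open>d\<omega>(u,v,w) = u(\<omega>(v,w)) - v(\<omega>(u,w)) + w(\<omega>(u,v))\<close>.
\<close>

definition exterior_derivative_1 ::
  "('a, 'e::euclidean_space) atlas \<Rightarrow> (('a, 'e) tangent \<Rightarrow> real)
    \<Rightarrow> ('a, 'e) tangent \<Rightarrow> ('a, 'e) tangent \<Rightarrow> real" where
  "exterior_derivative_1 M \<alpha> U V =
     (let p = fst U; c = chart_at M p; x = cmap c p; u = snd U c; v = snd V c;
          \<alpha>' = (\<lambda>a y. \<alpha> (tangent_vec M c (cinv c y) a))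
      in frechet_derivative (\<alpha>' v) (at x) u - frechet_derivative (\<alpha>' u) (at x) v)"

definition exterior_derivative_2 ::
  "('a, 'e::euclidean_space) atlas \<Rightarrow> (('a, 'e) tangent \<Rightarrow> ('a, 'e) tangent \<Rightarrow> real)
    \<Rightarrow> ('a, 'e) tangent \<Rightarrow> ('a, 'e) tangent \<Rightarrow> ('a, 'e) tangent \<Rightarrow> real" where
  "exterior_derivative_2 M \<omega> U V W =
     (let p = fst U; c = chart_at M p; x = cmap c p; u = snd U c; v = snd V c; w = snd W c;
          \<omega>' = (\<lambda>a b y. \<omega> (tangent_vec M c (cinv c y) a) (tangent_vec M c (cinv c y) b))
      in frechet_derivative (\<omega>' v w) (at x) u - frechet_derivative (\<omega>' u w) (at x) v
         + frechet_derivative (\<omega>' u v) (at x) w)"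

definition smooth_two_form ::
  "('a, 'e::euclidean_space) atlas \<Rightarrow> (('a, 'e) tangent \<Rightarrow> ('a, 'e) tangent \<Rightarrow> real) \<Rightarrow> bool" where
  "smooth_two_form M \<omega> \<longleftrightarrow>
     (\<forall>c\<in>M. \<forall>p\<in>cdom c. bilinear (\<lambda>u v. \<omega> (tangent_vec M c p u) (tangent_vec M c p v))) \<and>
     (\<forall>Z\<in>tangent_vectors M. \<omega> Z Z = 0) \<and>
     (\<forall>c\<in>M. \<forall>u v. smooth_on (cmap c ` cdom c)
        (\<lambda>x. \<omega> (tangent_vec M c (cinv c x) u) (tangent_vec M c (cinv c x) v)))"

definition symplectic_form ::
  "('a, 'e::euclidean_space) atlas \<Rightarrow> (('a, 'e) tangent \<Rightarrow> ('a, 'e) tangent \<Rightarrow> real) \<Rightarrow> bool" where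
  "symplectic_form M \<omega> \<longleftrightarrow>
     smooth_two_form M \<omega> \<and>
     (\<forall>U\<in>tangent_vectors M. \<forall>V\<in>tangent_vectors M. \<forall>W\<in>tangent_vectors M.
        fst V = fst U \<and> fst W = fst U \<longrightarrow> exterior_derivative_2 M \<omega> U V W = 0) \<and>
     (\<forall>U\<in>tangent_vectors M.
        (\<forall>V\<in>tangent_vectors M. fst V = fst U \<longrightarrow> \<omega> U V = 0) \<longrightarrow>
        (\<forall>c\<in>charts_at M (fst U). snd U c = 0))"


section \<open>Lagrangian mechanics\<close>

text \<open>
  \<open>\<theta>\<^sub>L = (\<partial>L/\<partial>v\<^sup>i) dq\<^sup>i\<close> in natural coordinates: the \<open>dq\<close>-components of a vector tangent to \<open>TQ\<close>
  are the first component of its coordinate vector.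
\<close>

definition cartan_one_form ::
  "('a, real^'n) atlas \<Rightarrow> (('a, real^'n) tangent \<Rightarrow> real)
    \<Rightarrow> (('a, real^'n) tangent, (real^'n) \<times> (real^'n)) tangent \<Rightarrow> real" where
  "cartan_one_form Q L Z =
     (let w = fst Z; c = tangent_chart Q (chart_at Q (fst w)) in
       \<Sum>i\<in>UNIV. frechet_derivative (L \<circ> cinv c) (at (cmap c w)) (0, axis i 1) * fst (snd Z c) $ i)"

definition cartan_two_form ::
  "('a, real^'n) atlas \<Rightarrow> (('a, real^'n) tangent \<Rightarrow> real)
    \<Rightarrow> (('a, real^'n) tangent, (real^'n) \<times> (real^'n)) tangent
    \<Rightarrow> (('a, real^'n) tangent, (real^'n) \<times> (real^'n)) tangent \<Rightarrow> real" where
  "cartan_two_form Q L U V = - exterior_derivative_1 (tangent_bundle Q) (cartan_one_form Q L) U V"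

text \<open>\<open>\<Delta> = v\<^sup>i \<partial>/\<partial>v\<^sup>i\<close>\<close>

definition liouville_vector_field ::
  "('a, 'e::euclidean_space) atlas
    \<Rightarrow> ('a, 'e) tangent \<Rightarrow> (('a, 'e) tangent, 'e \<times> 'e) tangent" where
  "liouville_vector_field Q w =
     (let c = chart_at Q (fst w) in
       tangent_vec (tangent_bundle Q) (tangent_chart Q c) w (0, snd w c))"

definition lagrangian_energy ::
  "('a, 'e::euclidean_space) atlas \<Rightarrow> (('a, 'e) tangent \<Rightarrow> real) \<Rightarrow> ('a, 'e) tangent \<Rightarrow> real" where
  "lagrangian_energy Q L w =
     differential (tangent_bundle Q) L (liouville_vector_field Q w) - L w"

definition regular_lagrangian ::
  "('a, real^'n) atlas \<Rightarrow> (('a, real^'n) tangent \<Rightarrow> real) \<Rightarrow> bool" where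
  "regular_lagrangian Q L \<longleftrightarrow> symplectic_form (tangent_bundle Q) (cartan_two_form Q L)"

text \<open>
  The solution of \<open>i(\<Gamma>)\<omega>\<^sub>L = dE\<^sub>L\<close>; extensionality removes the freedom of the values of
  \<open>\<Gamma>\<close> outside \<open>TQ\<close>, so that the solution is unique for regular \<open>L\<close>.
\<close>

definition lagrangian_vector_field ::
  "('a, real^'n) atlas \<Rightarrow> (('a, real^'n) tangent \<Rightarrow> real)
    \<Rightarrow> ('a, real^'n) tangent \<Rightarrow> (('a, real^'n) tangent, (real^'n) \<times> (real^'n)) tangent" where
  "lagrangian_vector_field Q L =
     (THE \<Gamma>. \<Gamma> \<in> extensional (tangent_vectors Q) \<and> vector_field (tangent_bundle Q) \<Gamma> \<and>
        (\<forall>Z\<in>tangent_vectors (tangent_bundle Q).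
           cartan_two_form Q L (\<Gamma> (fst Z)) Z =
           differential (tangent_bundle Q) (lagrangian_energy Q L) Z))"

definition generalized_HJ_solution ::
  "('a, real^'n) atlas \<Rightarrow> (('a, real^'n) tangent \<Rightarrow> real) \<Rightarrow> ('a \<Rightarrow> ('a, real^'n) tangent) \<Rightarrow> bool"
  where
  "generalized_HJ_solution Q L X \<longleftrightarrow>
     (\<forall>I \<gamma>. integral_curve Q X I \<gamma> \<longrightarrow>
        integral_curve (tangent_bundle Q) (lagrangian_vector_field Q L) I (X \<circ> \<gamma>))"

end

theory Submission
  imports Defs
begin

text \<open>
  By the chain rule, if \<open>\<gamma>\<close> is an integral curve of \<open>X\<close>, then \<open>X \<circ> \<gamma>\<close> is a differentiable
  curve with velocity \<open>TX \<circ> X \<circ> \<gamma>\<close>, so it is an integral curve of \<open>\<Gamma>\<^sub>L\<close> iff \<open>\<Gamma>\<^sub>L\<close> and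
  \<open>TX \<circ> X\<close> agree along \<open>\<gamma>\<close>. Since an integral curve of \<open>X\<close> passes through every point of \<open>Q\<close>
  (Picard--Lindelof in a chart), this holds for all \<open>\<gamma>\<close> iff \<open>\<Gamma>\<^sub>L \<circ> X = TX \<circ> X\<close>.
\<close>

section \<open>Short-time existence for ordinary differential equations\<close>

text \<open>
  Banach's fixed point theorem on bounded continuous functions on \<open>\<real>\<close>: the argument of the integral
  operator is clipped to \<open>[-a, a]\<close> to obtain functions defined on all of \<open>\<real>\<close>, and its integrals start
  at \<open>-a\<close> because \<open>integral {0..u}\<close> vanishes for \<open>u < 0\<close>.
\<close>

lemma lipschitz_ode_solution:
  fixes F :: "'e::euclidean_space \<Rightarrow> 'e"
  assumes F: "K-lipschitz_on UNIV F"
  obtains a g where "a > 0" "g 0 = x0"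
    "\<And>t. t \<in> {-a<..<a} \<Longrightarrow> (g has_vector_derivative F (g t)) (at t)"
proof -
  have K: "K \<ge> 0" using F by (rule lipschitz_on_nonneg)
  \<comment> \<open>This length makes the integral operator a contraction with constant
    \<open>1/2\<close>: the integrals up to \<open>clip t\<close> and up to \<open>0\<close>
    contribute at most \<open>2 * a * K\<close> and \<open>a * K\<close>.\<close>
  define a where "a = 1 / (6 * (K + 1))"
  have a: "a > 0" and aK: "3 * a * K \<le> 1/2"
    using K by (auto simp: a_def field_simps)
  have cF: "continuous_on S (\<lambda>s. F (apply_bcontfun g s))" for S and g :: "real \<Rightarrow>\<^sub>C 'e"
    using continuous_on_compose2[OF lipschitz_on_continuous_on[OF F] continuous_on_apply_bcontfun]
    by auto
  define clip where "clip t = max (-a) (min a t)" for t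
  have clip: "clip t \<in> {-a..a}" for t using a by (auto simp: clip_def)
  \<comment> \<open>The difference of the two integrals is the oriented integral from
    \<open>0\<close> to \<open>u\<close>, so that \<open>P g 0 = x0\<close> for every
    \<open>g\<close>.\<close>
  define P where "P g u = x0 + integral {-a..u} (\<lambda>s. F (g s)) - integral {-a..0} (\<lambda>s. F (g s))"
    for g :: "real \<Rightarrow> 'e" and u
  have der: "(P (apply_bcontfun g) has_vector_derivative F (g u)) (at u within {-a..a})"
    if "u \<in> {-a..a}" for g :: "real \<Rightarrow>\<^sub>C 'e" and u
    unfolding P_def
    using integral_has_vector_derivative[OF cF that, of g]
    by (auto intro!: derivative_eq_intros)
  have contP: "continuous_on {-a..a} (P (apply_bcontfun g))" for g :: "real \<Rightarrow>\<^sub>C 'e"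
    using der by (rule continuous_on_vector_derivative)
  \<comment> \<open>\<open>clip\<close> takes values in a compact interval, on which
    \<open>P g\<close> is continuous and hence bounded.\<close>
  have bc: "(\<lambda>t. P (apply_bcontfun g) (clip t)) \<in> bcontfun" for g :: "real \<Rightarrow>\<^sub>C 'e"
  proof -
    have "continuous_on UNIV (\<lambda>t. P (apply_bcontfun g) (clip t))"
      by (rule continuous_on_compose2[OF contP]) (use clip in \<open>auto simp: clip_def intro!: continuous_intros\<close>)
    moreover have "bounded (range (\<lambda>t. P (apply_bcontfun g) (clip t)))"
      by (rule bounded_subset[OF compact_imp_bounded[OF compact_continuous_image[OF contP]]])
        (use clip in auto)
    ultimately show ?thesis by (simp add: bcontfun_def)
  qed
  define T where "T g = Bcontfun (\<lambda>t. P (apply_bcontfun g) (clip t))" for g :: "real \<Rightarrow>\<^sub>C 'e"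
  have T: "apply_bcontfun (T g) t = P g (clip t)" for g t
    using Bcontfun_inverse[OF bc] by (simp add: T_def)
  have int_diff: "norm (integral {-a..u} (\<lambda>s. F (g s)) - integral {-a..u} (\<lambda>s. F (h s)))
      \<le> K * dist g h * (u + a)" if "u \<ge> -a" for g h :: "real \<Rightarrow>\<^sub>C 'e" and u
  proof -
    have "norm (integral {-a..u} (\<lambda>s. F (g s) - F (h s))) \<le> K * dist g h * (u - (-a))"
    proof (rule integral_bound)
      show "norm (F (g s) - F (h s)) \<le> K * dist g h" for s
        using lipschitz_onD[OF F, of "g s" "h s"] mult_left_mono[OF dist_bounded[of g s h] K]
        by (simp add: dist_norm)
    qed (use that cF in \<open>auto intro!: continuous_intros\<close>)
    then show ?thesis
      by (subst (asm) integral_diff) (auto intro!: integrable_continuous_real cF)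
  qed
  have "dist (T g) (T h) \<le> 1/2 * dist g h" for g h
  proof (rule dist_bound)
    fix t
    let ?I = "\<lambda>k u. integral {-a..u} (\<lambda>s. F (apply_bcontfun k s))"
    have "dist (T g t) (T h t) = norm ((?I g (clip t) - ?I h (clip t)) - (?I g 0 - ?I h 0))"
      by (simp add: T P_def dist_norm algebra_simps)
    also have "\<dots> \<le> K * dist g h * (clip t + a) + K * dist g h * (0 + a)"
      using clip[of t] a by (intro order_trans[OF norm_triangle_ineq4] add_mono int_diff) auto
    also have "\<dots> \<le> K * dist g h * (a + a) + K * dist g h * (0 + a)"
      using clip[of t] K by (intro add_mono mult_left_mono) auto
    also have "\<dots> = (3 * a * K) * dist g h" by (simp add: algebra_simps)
    also have "\<dots> \<le> 1/2 * dist g h" using aK by (intro mult_right_mono) auto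
    finally show "dist (T g t) (T h t) \<le> 1/2 * dist g h" .
  qed
  then obtain g where g: "T g = g"
    using banach_fix_type[of "1/2" T] by auto
  have gP: "apply_bcontfun g t = P g t" if "t \<in> {-a..a}" for t
    using T[of g t] that by (simp add: g clip_def)
  show thesis
  proof
    show "a > 0" by fact
    show "apply_bcontfun g 0 = x0" using gP[of 0] a by (simp add: P_def)
    fix t assume t: "t \<in> {-a<..<a}"
    \<comment> \<open>At interior points the derivative within \<open>{-a..a}\<close> is a full one.
      Passing from \<open>P g\<close> to \<open>g\<close> then needs their equality near
      \<open>t\<close>, which \<open>gP\<close> provides.\<close>
    have "(P g has_vector_derivative F (g t)) (at t within {-a<..<a})"
      by (rule has_vector_derivative_within_subset[OF der]) (use t in auto)
    then have "(P g has_vector_derivative F (g t)) (at t)"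
      using t by (simp only: at_within_open[OF t open_greaterThanLessThan])
    then show "(apply_bcontfun g has_vector_derivative F (g t)) (at t)"
      by (rule has_vector_derivative_transform_within_open[of _ _ _ "{-a<..<a}"]) (use t gP in auto)
  qed
qed

text \<open>
  Composition with the projection onto a ball around \<open>x0\<close> extends \<open>f\<close> to a globally Lipschitz map;
  by continuity the solution stays inside the ball for a short time.
\<close>

lemma C1_ode_solution:
  fixes f :: "'e::euclidean_space \<Rightarrow> 'e"
  assumes U: "open U" "x0 \<in> U"
    and f': "\<And>x. x \<in> U \<Longrightarrow> (f has_derivative f' x) (at x)"
    and cont: "\<And>v. continuous_on U (\<lambda>x. f' x v)"
  obtains a g where "a > 0" "g 0 = x0" "\<And>t. t \<in> {-a<..<a} \<Longrightarrow> g t \<in> U"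
    "\<And>t. t \<in> {-a<..<a} \<Longrightarrow> (g has_vector_derivative f (g t)) (at t)"
proof -
  define D where "D x = Blinfun (f' x)" for x
  have D: "blinfun_apply (D x) = f' x" if "x \<in> U" for x
    unfolding D_def using f'[OF that] by (intro bounded_linear_Blinfun_apply has_derivative_bounded_linear)
  \<comment> \<open>The space is finite-dimensional, so continuity of the derivative in each
    direction \<open>v\<close> gives continuity in operator norm.\<close>
  have contD: "continuous_on U D"
    by (rule continuous_on_blinfun_componentwise)
      (use cont D in \<open>simp cong: continuous_on_cong_simp add: simp_implies_def\<close>)
  \<comment> \<open>A dummy real time turns \<open>f\<close> into the right-hand side of a
    time-dependent equation, for which a continuous derivative yields local Lipschitz
    constants.\<close>
  have "local_lipschitz UNIV U (\<lambda>_::real. f)"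
    by (rule c1_implies_local_lipschitz[where f' = "\<lambda>(t, x). D x"])
      (use U f' D contD in \<open>auto simp: case_prod_unfold intro!: continuous_on_compose2[OF contD] continuous_intros\<close>)
  then obtain u K where u: "u > 0"
    and "\<And>s. s \<in> cball (0::real) u \<inter> UNIV \<Longrightarrow> K-lipschitz_on (cball x0 u \<inter> U) f"
    using local_lipschitzE[OF _ UNIV_I U(2)] by blast
  from this(2)[of 0] u have K: "K-lipschitz_on (cball x0 u \<inter> U) f" by simp
  obtain e where e: "e > 0" "cball x0 e \<subseteq> U"
    using U open_contains_cball by blast
  define r where "r = min u e"
  have r: "r > 0" "cball x0 r \<subseteq> U" "cball x0 r \<subseteq> cball x0 u \<inter> U"
    using u e by (auto simp: r_def)
  have K': "K-lipschitz_on (cball x0 r) f"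
    by (rule lipschitz_on_subset[OF K r(3)])
  define F where "F x = f (closest_point (cball x0 r) x)" for x
  have F: "K-lipschitz_on UNIV F"
  proof (rule lipschitz_onI)
    fix x y
    have "dist (F x) (F y) \<le> K * dist (closest_point (cball x0 r) x) (closest_point (cball x0 r) y)"
      unfolding F_def using r by (intro lipschitz_onD[OF K'] closest_point_in_set) auto
    also have "\<dots> \<le> K * dist x y"
      using r by (intro mult_left_mono closest_point_lipschitz lipschitz_on_nonneg[OF K]) auto
    finally show "dist (F x) (F y) \<le> K * dist x y" .
  qed (rule lipschitz_on_nonneg[OF K])
  obtain a g where a: "a > 0" and g: "g 0 = x0"
    "\<And>t. t \<in> {-a<..<a} \<Longrightarrow> (g has_vector_derivative F (g t)) (at t)"
    using lipschitz_ode_solution[OF F, where ?x0.0 = x0] by blast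
  have "continuous (at 0) g"
    using g(2)[of 0] a has_vector_derivative_continuous by auto
  then obtain b where b: "b > 0" "\<And>t. dist t 0 < b \<Longrightarrow> dist (g t) (g 0) < r"
    using r(1) unfolding continuous_at_eps_delta by blast
  have mem: "g t \<in> cball x0 r" if "t \<in> {- min a b<..<min a b}" for t
  proof -
    have "\<bar>t\<bar> < b" using that by auto
    then show ?thesis using b(2)[of t] g(1) by (simp add: dist_commute)
  qed
  show thesis
  proof
    show "min a b > 0" "g 0 = x0" using a b g by auto
    fix t assume t: "t \<in> {- min a b<..<min a b}"
    show "g t \<in> U" using mem[OF t] r by blast
    show "(g has_vector_derivative f (g t)) (at t)"
    proof -
      have "t \<in> {-a<..<a}" using t by auto
      from g(2)[OF this] show ?thesis using mem[OF t] by (simp add: F_def closest_point_self)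
    qed
  qed
qed


section \<open>Differentiability and the chain rule along curves\<close>

lemma frechet_derivative_chain_vector:
  assumes "(g has_vector_derivative v) (at t)" "G differentiable (at (g t))"
  shows "(G \<circ> g has_vector_derivative frechet_derivative G (at (g t)) v) (at t)"
proof -
  have G: "(G has_derivative frechet_derivative G (at (g t))) (at (g t))"
    using assms(2) frechet_derivative_works by blast
  have "(G \<circ> g has_derivative frechet_derivative G (at (g t)) \<circ> (\<lambda>x. x *\<^sub>R v)) (at t)"
    using assms(1) G unfolding has_vector_derivative_def by (rule diff_chain_at)
  moreover have "frechet_derivative G (at (g t)) \<circ> (\<lambda>x. x *\<^sub>R v)
      = (\<lambda>x. x *\<^sub>R frechet_derivative G (at (g t)) v)"
    by (simp add: o_def linear_cmul[OF has_derivative_linear[OF G]])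
  ultimately show ?thesis by (simp add: has_vector_derivative_def)
qed

lemma smooth_on_imp_differentiable:
  assumes "smooth_on S f" "x \<in> S"
  shows "f differentiable (at x)"
proof -
  have "Ck_on (Suc 0) S f" using assms(1) unfolding smooth_on_def by blast
  then show ?thesis using assms(2) by simp
qed

lemma smooth_on_imp_continuous_frechet_derivative:
  assumes "smooth_on S f"
  shows "continuous_on S (\<lambda>x. frechet_derivative f (at x) v)"
proof -
  have "Ck_on (Suc 0) S f" using assms unfolding smooth_on_def by blast
  then show ?thesis by simp
qed

section \<open>Charts, tangent vectors and the tangent bundle\<close>

lemma cinv_cmap: "smooth_atlas M \<Longrightarrow> c \<in> M \<Longrightarrow> p \<in> cdom c \<Longrightarrow> cinv c (cmap c p) = p"
  by (simp add: cinv_def smooth_atlas_def)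

lemma cinv_in_cdom: "y \<in> cmap c ` cdom c \<Longrightarrow> cinv c y \<in> cdom c"
  and cmap_cinv: "y \<in> cmap c ` cdom c \<Longrightarrow> cmap c (cinv c y) = y"
  unfolding cinv_def by (auto intro: inv_into_into f_inv_into_f)

lemma chart_at_in_charts_at: "p \<in> points M \<Longrightarrow> chart_at M p \<in> charts_at M p"
  unfolding chart_at_def by (rule someI_ex) (auto simp: points_def charts_at_def)

lemma openin_cdom:
  assumes "smooth_atlas M" "c \<in> M"
  shows "openin (manifold_topology M) (cdom c)"
  using assms unfolding openin_manifold_topology[OF assms(1)] smooth_atlas_def points_def by blast

lemma tangent_vectors_coordinate_change:
  assumes "w \<in> tangent_vectors M" "c \<in> charts_at M (fst w)" "d \<in> charts_at M (fst w)"
  shows "snd w d = frechet_derivative (cmap d \<circ> cinv c) (at (cmap c (fst w))) (snd w c)"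
  using assms unfolding tangent_vectors_def mem_Collect_eq case_prod_unfold by blast

text \<open>The base point is recovered because \<open>c\<close> is injective, the components in the
  other charts from the one in \<open>c\<close> by the transformation law, and the remaining values
  from extensionality.\<close>

lemma inj_on_tangent_chart:
  assumes "smooth_atlas M" "c \<in> M"
  shows "inj_on (cmap (tangent_chart M c)) (cdom (tangent_chart M c))"
proof (rule inj_onI)
  fix w z
  assume w: "w \<in> cdom (tangent_chart M c)" and z: "z \<in> cdom (tangent_chart M c)"
    and eq: "cmap (tangent_chart M c) w = cmap (tangent_chart M c) z"
  obtain p \<xi> where wp: "w = (p, \<xi>)" by (cases w)
  obtain q \<eta> where zq: "z = (q, \<eta>)" by (cases z)
  have pq: "p \<in> cdom c" "q \<in> cdom c" "cmap c p = cmap c q" "\<xi> c = \<eta> c"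
    using w z eq by (auto simp: wp zq tangent_chart_def)
  then have "p = q"
    using assms unfolding smooth_atlas_def by (meson inj_onD)
  moreover have "\<xi> d = \<eta> d" for d
  proof (cases "d \<in> charts_at M p")
    case True
    have "c \<in> charts_at M p" using pq assms by (simp add: charts_at_def)
    moreover have "w \<in> tangent_vectors M" "z \<in> tangent_vectors M"
      using w z by (simp_all add: tangent_chart_def)
    ultimately show ?thesis
      using True tangent_vectors_coordinate_change[of _ M c d] pq
      by (metis fst_conv snd_conv wp zq \<open>p = q\<close>)
  next
    case False
    have ext: "\<xi> \<in> extensional (charts_at M p)" "\<eta> \<in> extensional (charts_at M p)"
      using w z by (simp_all add: wp zq \<open>p = q\<close> tangent_chart_def tangent_vectors_def)
    show ?thesis
      using extensional_arb[OF ext(1) False] extensional_arb[OF ext(2) False] by (rule trans[OF _ sym])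
  qed
  ultimately show "w = z" by (auto simp: wp zq)
qed

text \<open>
  Injectivity of the charts suffices here, which spares the proof that the tangent bundle
  has smooth coordinate changes.
\<close>

lemma topspace_manifold_topology_subset:
  assumes inj: "\<And>c. c \<in> M \<Longrightarrow> inj_on (cmap c) (cdom c)"
  shows "topspace (manifold_topology M) \<subseteq> points M"
proof -
  let ?open = "\<lambda>W. W \<subseteq> points M \<and> (\<forall>c\<in>M. open (cmap c ` (cdom c \<inter> W)))"
  have "istopology ?open"
    unfolding istopology_def
  proof (intro conjI allI impI ballI)
    fix S T c
    assume S: "?open S" and T: "?open T"
    show "S \<inter> T \<subseteq> points M" using S by blast
    assume c: "c \<in> M"
    have "cmap c ` (cdom c \<inter> (S \<inter> T)) = cmap c ` ((cdom c \<inter> S) \<inter> (cdom c \<inter> T))"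
      by (simp add: Int_ac)
    also have "\<dots> = cmap c ` (cdom c \<inter> S) \<inter> cmap c ` (cdom c \<inter> T)"
      using inj[OF c] by (rule inj_on_image_Int) simp_all
    finally show "open (cmap c ` (cdom c \<inter> (S \<inter> T)))"
      using S T c by (simp add: open_Int)
  next
    fix K c
    assume K: "\<forall>W\<in>K. ?open W"
    show "\<Union>K \<subseteq> points M" using K by blast
    assume c: "c \<in> M"
    have "cmap c ` (cdom c \<inter> \<Union>K) = (\<Union>W\<in>K. cmap c ` (cdom c \<inter> W))"
      by blast
    then show "open (cmap c ` (cdom c \<inter> \<Union>K))"
      using K c by auto
  qed
  then have "openin (manifold_topology M) = ?open"
    unfolding manifold_topology_def by (simp only: topology_inverse')
  then show ?thesis
    using openin_topspace[of "manifold_topology M"] by simp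
qed

text \<open>The coordinate condition in \<open>smooth_map\<close> speaks only of points that land in
  a chart domain. It is the continuity of \<open>X\<close> that forces its values into the
  topological space of the bundle.\<close>

lemma vector_field_in_tangent_vectors:
  assumes "smooth_atlas M" "vector_field M X" "p \<in> points M"
  shows "X p \<in> tangent_vectors M"
proof -
  have "topspace (manifold_topology (tangent_bundle M)) \<subseteq> tangent_vectors M"
    unfolding points_tangent_bundle[symmetric]
    by (rule topspace_manifold_topology_subset)
      (use inj_on_tangent_chart[OF assms(1)] in \<open>auto simp only: tangent_bundle_def\<close>)
  moreover have "X p \<in> topspace (manifold_topology (tangent_bundle M))"
    using assms continuous_map_image_subset_topspace
    by (fastforce simp: vector_field_def smooth_map_def topspace_manifold_topology)
  ultimately show ?thesis by blast
qed

section \<open>Images of differentiable curves under smooth maps\<close>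

lemma curve_in_points:
  assumes "smooth_atlas M" "differentiable_curve M I \<gamma>" "t \<in> I"
  shows "\<gamma> t \<in> points M"
proof -
  have "\<gamma> ` topspace (top_of_set I) \<subseteq> topspace (manifold_topology M)"
    using assms(2) unfolding differentiable_curve_def
    by (intro continuous_map_image_subset_topspace) (rule conjunct1)
  then show ?thesis
    using assms(3) by (auto simp: topspace_manifold_topology[OF assms(1)])
qed

text \<open>Near \<open>t\<close> the image curve in coordinates is
  \<open>cmap d \<circ> F \<circ> cinv c\<close> after \<open>cmap c \<circ> \<gamma>\<close>, so
  the chain rule applies. This yields both differentiability and the velocity of the image
  curve.\<close>

lemma has_vector_derivative_smooth_map_curve:
  assumes M: "smooth_atlas M" and F: "smooth_map M N F"
    and I: "open I" "t \<in> I" and \<gamma>: "differentiable_curve M I \<gamma>"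
    and c: "c \<in> charts_at M (\<gamma> t)" and d: "d \<in> charts_at N (F (\<gamma> t))"
  shows "(cmap d \<circ> (F \<circ> \<gamma>) has_vector_derivative
    frechet_derivative (cmap d \<circ> F \<circ> cinv c) (at (cmap c (\<gamma> t)))
      (vector_derivative (cmap c \<circ> \<gamma>) (at t))) (at t)"
proof -
  have cM: "c \<in> M" "\<gamma> t \<in> cdom c" and dN: "d \<in> N" "F (\<gamma> t) \<in> cdom d"
    using c d by (auto simp: charts_at_def)
  have deriv: "(cmap c \<circ> \<gamma> has_vector_derivative vector_derivative (cmap c \<circ> \<gamma>) (at t)) (at t)"
    using \<gamma> I c by (auto simp: differentiable_curve_def vector_derivative_works[symmetric])
  have "(cmap d \<circ> F \<circ> cinv c) differentiable (at ((cmap c \<circ> \<gamma>) t))"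
    by (rule smooth_on_imp_differentiable[of "cmap c ` (cdom c \<inter> F -` cdom d)"])
      (use F cM dN in \<open>auto simp: smooth_map_def\<close>)
  from frechet_derivative_chain_vector[OF deriv this]
  have 1: "((cmap d \<circ> F \<circ> cinv c) \<circ> (cmap c \<circ> \<gamma>) has_vector_derivative
    frechet_derivative (cmap d \<circ> F \<circ> cinv c) (at (cmap c (\<gamma> t)))
      (vector_derivative (cmap c \<circ> \<gamma>) (at t))) (at t)"
    by (simp add: o_def)
  \<comment> \<open>\<open>cinv c\<close> cancels \<open>cmap c\<close> only while the curve is in
    \<open>cdom c\<close>; by continuity of \<open>\<gamma>\<close> these times form an open
    set.\<close>
  have "openin (top_of_set I) {s \<in> I. \<gamma> s \<in> cdom c}"
    using openin_continuous_map_preimage[OF _ openin_cdom[OF M cM(1)], of "top_of_set I" \<gamma>] \<gamma>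
    by (simp add: differentiable_curve_def)
  then have "open {s \<in> I. \<gamma> s \<in> cdom c}"
    using I(1) openin_open_trans by blast
  with 1 show ?thesis
    by (rule has_vector_derivative_transform_within_open) (use I cM M in \<open>auto simp: cinv_cmap\<close>)
qed

lemma differentiable_curve_smooth_map:
  assumes M: "smooth_atlas M" and F: "smooth_map M N F"
    and I: "open I" and \<gamma>: "differentiable_curve M I \<gamma>"
  shows "differentiable_curve N I (F \<circ> \<gamma>)"
  unfolding differentiable_curve_def
proof (intro conjI ballI)
  show "continuous_map (top_of_set I) (manifold_topology N) (F \<circ> \<gamma>)"
    using F \<gamma> by (auto simp: smooth_map_def differentiable_curve_def intro: continuous_map_compose)
  fix t d
  assume "t \<in> I" "d \<in> charts_at N ((F \<circ> \<gamma>) t)"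
  then show "(cmap d \<circ> (F \<circ> \<gamma>)) differentiable (at t)"
    using has_vector_derivative_smooth_map_curve[OF M F I _ \<gamma>]
      chart_at_in_charts_at[OF curve_in_points[OF M \<gamma>]]
    by (metis comp_apply differentiableI_vector)
qed

text \<open>\<open>tangent_map\<close> computes in the chart \<open>chart_at M (\<gamma> t)\<close>;
  the chain rule for this chart gives every component of the new velocity.\<close>

lemma velocity_smooth_map:
  assumes M: "smooth_atlas M" and F: "smooth_map M N F"
    and I: "open I" "t \<in> I" and \<gamma>: "differentiable_curve M I \<gamma>"
  shows "velocity N (F \<circ> \<gamma>) t = tangent_map M N F (velocity M \<gamma> t)"
proof -
  have c: "chart_at M (\<gamma> t) \<in> charts_at M (\<gamma> t)"
    using curve_in_points[OF M \<gamma> I(2)] by (rule chart_at_in_charts_at)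
  have "vector_derivative (cmap d \<circ> (F \<circ> \<gamma>)) (at t) =
      frechet_derivative (cmap d \<circ> F \<circ> cinv (chart_at M (\<gamma> t))) (at (cmap (chart_at M (\<gamma> t)) (\<gamma> t)))
        (vector_derivative (cmap (chart_at M (\<gamma> t)) \<circ> \<gamma>) (at t))"
    if "d \<in> charts_at N (F (\<gamma> t))" for d
    using has_vector_derivative_smooth_map_curve[OF M F I \<gamma> c that] by (rule vector_derivative_at)
  then show ?thesis
    using c by (auto simp: velocity_def tangent_map_def Let_def intro!: restrict_ext)
qed

section \<open>Existence of integral curves on a manifold\<close>

text \<open>In a chart \<open>c\<close> around \<open>q\<close> the field has smooth components, so
  the local equation is solvable, and \<open>cinv c\<close> carries the solution to the manifold.
  The transformation law of tangent vectors then gives the right velocity in all other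
  charts.\<close>

lemma integral_curve_through_point:
  assumes M: "smooth_atlas M" and X: "vector_field M X" and q: "q \<in> points M"
  obtains I \<gamma> where "0 \<in> I" "\<gamma> 0 = q" "integral_curve M X I \<gamma>"
proof -
  obtain c where c: "c \<in> M" "q \<in> cdom c" using q by (auto simp: points_def)
  define U where "U = cmap c ` cdom c"
  define d where "d = tangent_chart M c"
  \<comment> \<open>In natural coordinates \<open>h y\<close> is the pair of \<open>y\<close> and
    the coordinate vector of \<open>X\<close> at \<open>cinv c y\<close>; its second component is
    the right-hand side of the equation.\<close>
  define h where "h = cmap d \<circ> X \<circ> cinv c"
  have cpt: "p \<in> points M" if "p \<in> cdom c" for p
    using that c by (auto simp: points_def)
  have Xp: "X p \<in> tangent_vectors M" "fst (X p) = p" if "p \<in> points M" for p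
    using that vector_field_in_tangent_vectors[OF M X] X by (auto simp: vector_field_def)
  \<comment> \<open>\<open>smooth_map\<close> gives smoothness on the part of \<open>cdom c\<close>
    that \<open>X\<close> maps into \<open>cdom d\<close>; as \<open>X\<close> is a section, this is
    all of \<open>cdom c\<close>.\<close>
  have "cdom c \<inter> X -` cdom d = cdom c"
    using Xp cpt by (auto simp: d_def tangent_chart_def)
  moreover have "d \<in> tangent_bundle M" using c by (simp add: d_def tangent_bundle_def)
  ultimately have h: "smooth_on U h"
    using X c unfolding vector_field_def smooth_map_def U_def h_def by metis
  have U: "open U" "cmap c q \<in> U" using M c by (auto simp: U_def smooth_atlas_def)
  have h': "((\<lambda>y. snd (h y)) has_derivative (\<lambda>v. snd (frechet_derivative h (at y) v))) (at y)"
    if "y \<in> U" for y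
    using smooth_on_imp_differentiable[OF h that]
    by (intro has_derivative_snd) (simp add: frechet_derivative_works)
  have h'_cont: "continuous_on U (\<lambda>y. snd (frechet_derivative h (at y) v))" for v
    using smooth_on_imp_continuous_frechet_derivative[OF h] by (intro continuous_on_snd)
  obtain a g where a: "a > 0" and g0: "g 0 = cmap c q"
    and gU: "\<And>t. t \<in> {-a<..<a} \<Longrightarrow> g t \<in> U"
    and g': "\<And>t. t \<in> {-a<..<a} \<Longrightarrow> (g has_vector_derivative snd (h (g t))) (at t)"
    using C1_ode_solution[OF U h' h'_cont] by blast
  define \<gamma> where "\<gamma> = cinv c \<circ> g"
  have \<gamma>c: "\<gamma> t \<in> cdom c" "cmap c (\<gamma> t) = g t" if "t \<in> {-a<..<a}" for t
    using gU[OF that] by (auto simp: \<gamma>_def U_def intro: cinv_in_cdom cmap_cinv)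
  have deriv: "(cmap e \<circ> \<gamma> has_vector_derivative snd (X (\<gamma> t)) e) (at t)"
    if t: "t \<in> {-a<..<a}" and e: "e \<in> charts_at M (\<gamma> t)" for t e
  proof -
    have e': "e \<in> M" "\<gamma> t \<in> cdom e" using e by (auto simp: charts_at_def)
    have "(cmap e \<circ> cinv c) differentiable (at (g t))"
      by (rule smooth_on_imp_differentiable[of "cmap c ` (cdom c \<inter> cdom e)"])
        (use M c e' \<gamma>c[OF t] in \<open>auto simp: smooth_atlas_def image_iff intro: bexI[of _ "\<gamma> t"]\<close>)
    from frechet_derivative_chain_vector[OF g'[OF t] this]
    have "(cmap e \<circ> \<gamma> has_vector_derivative
        frechet_derivative (cmap e \<circ> cinv c) (at (cmap c (\<gamma> t))) (snd (X (\<gamma> t)) c)) (at t)"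
      unfolding \<gamma>c(2)[OF t] by (simp add: \<gamma>_def h_def d_def tangent_chart_def o_def)
    moreover have "snd (X (\<gamma> t)) e =
        frechet_derivative (cmap e \<circ> cinv c) (at (cmap c (\<gamma> t))) (snd (X (\<gamma> t)) c)"
    proof -
      have "c \<in> charts_at M (\<gamma> t)" using \<gamma>c[OF t] c by (simp add: charts_at_def)
      then show ?thesis
        using tangent_vectors_coordinate_change[of "X (\<gamma> t)" M c e]
          Xp[OF cpt[OF \<gamma>c(1)[OF t]]] e by metis
    qed
    ultimately show ?thesis by simp
  qed
  have "continuous_map (top_of_set {-a<..<a}) (manifold_topology M) \<gamma>"
    unfolding continuous_map
  proof (intro conjI allI impI)
    show "\<gamma> ` topspace (top_of_set {-a<..<a}) \<subseteq> topspace (manifold_topology M)"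
      using \<gamma>c cpt by (auto simp: topspace_manifold_topology[OF M])
    fix W assume "openin (manifold_topology M) W"
    then have W: "open (cmap c ` (cdom c \<inter> W))"
      using c by (simp add: openin_manifold_topology[OF M])
    \<comment> \<open>The preimage of \<open>W\<close> under \<open>\<gamma>\<close> is thereby the
      preimage under \<open>g\<close> of an open set of coordinates.\<close>
    have "g t \<in> cmap c ` (cdom c \<inter> W) \<longleftrightarrow> \<gamma> t \<in> W" if "t \<in> {-a<..<a}" for t
      using \<gamma>c[OF that] by (auto simp: \<gamma>_def cinv_cmap[OF M c(1)] intro!: rev_image_eqI)
    then have "{t \<in> topspace (top_of_set {-a<..<a}). \<gamma> t \<in> W}
        = {-a<..<a} \<inter> g -` (cmap c ` (cdom c \<inter> W))"
      by (auto simp del: greaterThanLessThan_iff image_iff)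
    moreover have "continuous_on {-a<..<a} g"
      using g' by (intro continuous_at_imp_continuous_on ballI) (rule has_vector_derivative_continuous)
    ultimately show "openin (top_of_set {-a<..<a}) {t \<in> topspace (top_of_set {-a<..<a}). \<gamma> t \<in> W}"
      using W by (simp only: continuous_openin_preimage_gen)
  qed
  then have "differentiable_curve M {-a<..<a} \<gamma>"
    using deriv unfolding differentiable_curve_def by (blast intro: differentiableI_vector)
  moreover have "velocity M \<gamma> t = X (\<gamma> t)" if t: "t \<in> {-a<..<a}" for t
  proof -
    \<comment> \<open>Both families of components are extensional, so comparing them on the charts
      around \<open>\<gamma> t\<close> suffices.\<close>
    have "snd (X (\<gamma> t)) \<in> extensional (charts_at M (\<gamma> t))"
      using Xp[OF cpt[OF \<gamma>c(1)[OF t]]] unfolding tangent_vectors_def by auto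
    then have "(\<lambda>e\<in>charts_at M (\<gamma> t). vector_derivative (cmap e \<circ> \<gamma>) (at t)) = snd (X (\<gamma> t))"
      by (intro extensionalityI[of _ "charts_at M (\<gamma> t)"])
        (simp_all add: vector_derivative_at[OF deriv[OF t]])
    then show ?thesis
      using Xp(2)[OF cpt[OF \<gamma>c(1)[OF t]]] by (simp add: velocity_def prod_eq_iff)
  qed
  ultimately have "integral_curve M X {-a<..<a} \<gamma>"
    by (simp add: integral_curve_def is_interval_oo)
  moreover have "\<gamma> 0 = q" by (simp add: \<gamma>_def g0 cinv_cmap[OF M c])
  ultimately show thesis using a by (intro that[of "{-a<..<a}" \<gamma>]) auto
qed

section \<open>Solutions of the Hamilton-Jacobi problem and \<open>X\<close>-related fields\<close>

theorem proposition1: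
  fixes Q :: "('a, real^'n) atlas"
    and L :: "('a, real^'n) tangent \<Rightarrow> real"
    and X :: "'a \<Rightarrow> ('a, real^'n) tangent"
  assumes "smooth_manifold Q"
    and "smooth_function (tangent_bundle Q) L"
    and "regular_lagrangian Q L"
    and "vector_field Q X"
  shows "generalized_HJ_solution Q L X \<longleftrightarrow>
    (\<forall>q\<in>points Q. lagrangian_vector_field Q L (X q) = tangent_map Q (tangent_bundle Q) X (X q))"
proof -
  have Q: "smooth_atlas Q" using assms(1) by (simp add: smooth_manifold_def)
  have X: "smooth_map Q (tangent_bundle Q) X" using assms(4) by (simp add: vector_field_def)
  \<comment> \<open>Naturality of the velocity, with the velocity of \<open>\<gamma>\<close>
    replaced by \<open>X (\<gamma> t)\<close>.\<close>
  have vel: "velocity (tangent_bundle Q) (X \<circ> \<gamma>) t = tangent_map Q (tangent_bundle Q) X (X (\<gamma> t))"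
    if "integral_curve Q X I \<gamma>" "t \<in> I" for I \<gamma> t
    using that velocity_smooth_map[OF Q X, of I t \<gamma>] by (simp add: integral_curve_def)
  show ?thesis
  proof
    assume sol: "generalized_HJ_solution Q L X"
    show "\<forall>q\<in>points Q. lagrangian_vector_field Q L (X q) = tangent_map Q (tangent_bundle Q) X (X q)"
    proof
      fix q assume "q \<in> points Q"
      then obtain I \<gamma> where \<gamma>: "0 \<in> I" "\<gamma> 0 = q" "integral_curve Q X I \<gamma>"
        by (rule integral_curve_through_point[OF Q assms(4)])
      then have "integral_curve (tangent_bundle Q) (lagrangian_vector_field Q L) I (X \<circ> \<gamma>)"
        using sol by (simp add: generalized_HJ_solution_def)
      \<comment> \<open>Both sides are the velocity of \<open>X \<circ> \<gamma>\<close> at time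
        \<open>0\<close>, where \<open>\<gamma>\<close> is at \<open>q\<close>.\<close>
      then show "lagrangian_vector_field Q L (X q) = tangent_map Q (tangent_bundle Q) X (X q)"
        using vel[OF \<gamma>(3,1)] \<gamma>(1,2) by (simp add: integral_curve_def)
    qed
  next
    assume rel: "\<forall>q\<in>points Q. lagrangian_vector_field Q L (X q) = tangent_map Q (tangent_bundle Q) X (X q)"
    show "generalized_HJ_solution Q L X"
      unfolding generalized_HJ_solution_def
    proof (intro allI impI)
      fix I \<gamma> assume int: "integral_curve Q X I \<gamma>"
      then have \<gamma>: "open I" "is_interval I" "differentiable_curve Q I \<gamma>"
        by (simp_all add: integral_curve_def)
      then show "integral_curve (tangent_bundle Q) (lagrangian_vector_field Q L) I (X \<circ> \<gamma>)"
        using differentiable_curve_smooth_map[OF Q X \<gamma>(1,3)] vel[OF int] rel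
          curve_in_points[OF Q \<gamma>(3)]
        by (simp add: integral_curve_def)
    qed
  qed
qed

end
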